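(* Let $d\ge1$, $T>0$, $A_0\in\mathcal{K}_c(\mathbb{R}^d)$, and let $f:[0,T]\times\Sigma(\mathbb{R}^d)\to\hat\Sigma(\mathbb{R}^d)$ be continuous (with respect to the maximum norm) and Lipschitz continuous in its second argument, i.e. assume that there exists $L>0$ such that $$\|f(t,\sigma_A)-f(t,\sigma_B)\|_\infty\le L\|\sigma_A-\sigma_B\|_\infty\quad\text{for all } t\in[0,T],\ A,B\in\mathcal{K}_c(\mathbb{R}^d).$$ If, in addition, $f$ satisfies $$f(t,\sigma)\in\overline{\Sigma(\mathbb{R}^d)-\mathbb{R}_0^+\sigma}\quad\text{for all } t\in[0,T],\ \sigma\in\Sigma(\mathbb{R}^d),$$ then there exists a unique solution $\sigma:[0,T]\to\Sigma(\mathbb{R}^d)$ of the initial value problem $$\tfrac{d}{dt}\sigma(t)=f(t,\sigma(t)),\quad \sigma(0)=\sigma_{A_0}.$$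
   Context: $\mathcal{K}_c(\mathbb{R}^d)$ is the family of nonempty convex compact subsets of $\mathbb{R}^d$. $\mathbb{S}^{d-1}\subset\mathbb{R}^d$ is the Euclidean unit sphere and $C(\mathbb{S}^{d-1})$ is the Banach space of continuous real-valued functions on it with the maximum norm $\|\cdot\|_\infty$. For $A\in\mathcal{K}_c(\mathbb{R}^d)$ the support function is $\sigma_A:\mathbb{S}^{d-1}\to\mathbb{R}$, $\sigma_A(p)=\sup_{a\in A}\langle p,a\rangle$; it belongs to $C(\mathbb{S}^{d-1})$, and $\|\sigma_A-\sigma_B\|_\infty$ equals the Hausdorff distance of $A$ and $B$. Set $\Sigma(\mathbb{R}^d):=\{\sigma_A:A\in\mathcal{K}_c(\mathbb{R}^d)\}$ and $\hat\Sigma(\mathbb{R}^d):=\{\sigma_A-\sigma_B:A,B\in\mathcal{K}_c(\mathbb{R}^d)\}$, both regarded as subsets of $C(\mathbb{S}^{d-1})$. $\mathbb{R}_0^+=[0,\infty)$, and $\Sigma(\mathbb{R}^d)-\mathbb{R}_0^+\sigma=\{\tau-\lambda\sigma:\tau\in\Sigma(\mathbb{R}^d),\ \lambda\ge0\}$; the closure is taken in $C(\mathbb{S}^{d-1})$. A solution on $[0,T]$ is a continuous curve $\sigma:[0,T]\to C(\mathbb{S}^{d-1})$ with values in $\Sigma(\mathbb{R}^d)$ that satisfies the initial condition and is Fréchet differentiable (with respect to $\|\cdot\|_\infty$) with the differential equation holding at every $t\in(0,T)$. *)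

theory Defs
  imports "HOL-Analysis.Analysis"
begin

text \<open>
  The unit sphere as a type, so that the library type \<open>'a usphere \<Rightarrow>\<^sub>C real\<close> of bounded continuous
  functions with the supremum norm can serve as the Banach space of continuous functions on the
  sphere. By compactness, boundedness is automatic and the supremum is a maximum; see
  \<open>continuous_imp_bcontfun\<close> and \<open>norm_usphere_attained\<close> below.
\<close>

typedef (overloaded) 'a usphere = "sphere (0 :: 'a::euclidean_space) 1"
  morphisms point_of Usphere
  using vector_choose_size[of 1, where 'a='a] by auto

setup_lifting type_definition_usphere

instantiation usphere :: (euclidean_space) metric_space
begin

lift_definition dist_usphere :: "'a usphere \<Rightarrow> 'a usphere \<Rightarrow> real" is dist .

definition uniformity_usphere :: "('a usphere \<times> 'a usphere) filter"
  where "uniformity_usphere = (INF e\<in>{0<..}. principal {(p, q). dist p q < e})"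

definition open_usphere :: "'a usphere set \<Rightarrow> bool"
  where "open_usphere U \<longleftrightarrow> (\<forall>p\<in>U. eventually (\<lambda>(p', q). p' = p \<longrightarrow> q \<in> U) uniformity)"

instance
proof
  fix p q r :: "'a usphere"
  show "(dist p q = 0) = (p = q)"
    by transfer simp
  show "dist p q \<le> dist p r + dist q r"
    by transfer (rule dist_triangle2)
qed (simp_all add: uniformity_usphere_def open_usphere_def)

end

lemma norm_point_of [simp]: "norm (point_of p) = 1"
  using point_of[of p] by simp

lemma continuous_on_point_of: "continuous_on S point_of"
  unfolding continuous_on_iff by (metis dist_usphere.rep_eq)

lemma compact_UNIV_usphere: "compact (UNIV :: 'a::euclidean_space usphere set)"
proof -
  have "continuous_on (sphere (0::'a) 1) Usphere"
    unfolding continuous_on_iff by (metis Usphere_inverse dist_usphere.rep_eq)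
  then have "compact (Usphere ` sphere (0::'a) 1)"
    by (rule compact_continuous_image) simp
  moreover have "Usphere ` sphere (0::'a) 1 = UNIV"
    by (metis UNIV_eq_I image_eqI point_of point_of_inverse)
  ultimately show ?thesis by simp
qed

lemma continuous_imp_bcontfun:
  fixes g :: "'a::euclidean_space usphere \<Rightarrow> real"
  assumes "continuous_on UNIV g"
  shows "g \<in> bcontfun"
  using assms compact_imp_bounded[OF compact_continuous_image[OF assms compact_UNIV_usphere]]
  by (simp add: bcontfun_def)

lemma norm_usphere_attained:
  fixes \<phi> :: "'a::euclidean_space usphere \<Rightarrow>\<^sub>C real"
  obtains p where "norm \<phi> = \<bar>apply_bcontfun \<phi> p\<bar>" "\<And>q. \<bar>apply_bcontfun \<phi> q\<bar> \<le> norm \<phi>"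
proof -
  have "continuous_on UNIV (\<lambda>q. \<bar>apply_bcontfun \<phi> q\<bar>)"
    by (intro continuous_intros continuous_on_apply_bcontfun)
  then obtain p where p: "\<And>q. \<bar>apply_bcontfun \<phi> q\<bar> \<le> \<bar>apply_bcontfun \<phi> p\<bar>"
    using continuous_attains_sup[OF compact_UNIV_usphere] by blast
  have le: "\<bar>apply_bcontfun \<phi> q\<bar> \<le> norm \<phi>" for q
    using norm_bounded[of \<phi> q] by simp
  have "norm \<phi> \<le> \<bar>apply_bcontfun \<phi> p\<bar>"
    by (rule norm_bound) (simp add: p)
  with le show ?thesis by (intro that[of p]) (auto intro: antisym)
qed

definition convex_bodies :: "'a::euclidean_space set set"
  where "convex_bodies = {A. A \<noteq> {} \<and> convex A \<and> compact A}"

text \<open>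
  \<open>Bcontfun\<close> is only meaningful on continuous functions; \<open>apply_support_fun\<close> shows that the
  defining formula holds for all members of \<open>convex_bodies\<close>.
\<close>

definition support_fun :: "'a::euclidean_space set \<Rightarrow> ('a usphere \<Rightarrow>\<^sub>C real)"
  where "support_fun A = Bcontfun (\<lambda>p. SUP a\<in>A. point_of p \<bullet> a)"

lemma apply_support_fun:
  fixes A :: "'a::euclidean_space set"
  assumes "A \<in> convex_bodies"
  shows "apply_bcontfun (support_fun A) p = (SUP a\<in>A. point_of p \<bullet> a)"
proof -
  have ne: "A \<noteq> {}" and "compact A"
    using assms by (auto simp: convex_bodies_def)
  then obtain M where M: "M > 0" "\<And>a. a \<in> A \<Longrightarrow> norm a \<le> M"
    using compact_imp_bounded bounded_pos by metis
  have bdd: "bdd_above ((\<lambda>a. point_of p \<bullet> a) ` A)" for p :: "'a usphere"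
  proof (rule bdd_aboveI2)
    fix a assume "a \<in> A"
    then show "point_of p \<bullet> a \<le> M"
      using norm_cauchy_schwarz[of "point_of p" a] M(2)[of a] by simp
  qed
  let ?s = "\<lambda>p::'a usphere. SUP a\<in>A. point_of p \<bullet> a"
  have half: "?s p \<le> ?s q + M * dist p q" for p q :: "'a usphere"
  proof (rule cSUP_least[OF ne])
    fix a assume a: "a \<in> A"
    have "point_of p \<bullet> a - point_of q \<bullet> a \<le> norm (point_of p - point_of q) * norm a"
      by (metis inner_diff_left norm_cauchy_schwarz)
    also have "\<dots> \<le> norm (point_of p - point_of q) * M"
      using M(2)[OF a] by (intro mult_left_mono) auto
    also have "\<dots> = M * dist p q"
      by (simp add: dist_usphere.rep_eq dist_norm)
    finally show "point_of p \<bullet> a \<le> ?s q + M * dist p q"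
      using cSUP_upper[OF a bdd[of q]] by linarith
  qed
  have "M-lipschitz_on UNIV ?s"
  proof (rule lipschitz_onI)
    fix p q :: "'a usphere"
    show "dist (?s p) (?s q) \<le> M * dist p q"
      using half[of p q] half[of q p] by (auto simp: dist_real_def dist_commute abs_le_iff)
  qed (use M in simp)
  then have "?s \<in> bcontfun"
    by (intro continuous_imp_bcontfun lipschitz_on_continuous_on)
  then show ?thesis
    by (simp add: support_fun_def Bcontfun_inverse)
qed

definition support_funs :: "('a::euclidean_space usphere \<Rightarrow>\<^sub>C real) set"
  where "support_funs = {support_fun A | A. A \<in> convex_bodies}"

definition diff_support_funs :: "('a::euclidean_space usphere \<Rightarrow>\<^sub>C real) set"
  where "diff_support_funs =
    {support_fun A - support_fun B | A B. A \<in> convex_bodies \<and> B \<in> convex_bodies}"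

definition support_funs_minus_ray ::
    "('a::euclidean_space usphere \<Rightarrow>\<^sub>C real) \<Rightarrow> ('a usphere \<Rightarrow>\<^sub>C real) set"
  where "support_funs_minus_ray \<sigma> = {\<tau> - c *\<^sub>R \<sigma> | \<tau> c. \<tau> \<in> support_funs \<and> c \<ge> 0}"

text \<open>
  Curves on \<open>{0..T}\<close> are represented by extensional functions (value \<open>undefined\<close> outside
  \<open>{0..T}\<close>), so that equality of curves is equality of functions on \<open>{0..T}\<close>. For
  \<open>t \<in> {0<..<T}\<close> the two-sided derivative at \<open>t\<close> depends only on values inside \<open>{0..T}\<close>.
\<close>

definition ivp_solution ::
    "real \<Rightarrow> (real \<Rightarrow> ('a::euclidean_space usphere \<Rightarrow>\<^sub>C real) \<Rightarrow> ('a usphere \<Rightarrow>\<^sub>C real)) \<Rightarrow>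
     ('a usphere \<Rightarrow>\<^sub>C real) \<Rightarrow> (real \<Rightarrow> ('a usphere \<Rightarrow>\<^sub>C real)) \<Rightarrow> bool"
  where "ivp_solution T f \<sigma>\<^sub>0 \<sigma> \<longleftrightarrow>
    \<sigma> \<in> {0..T} \<rightarrow>\<^sub>E support_funs \<and>
    continuous_on {0..T} \<sigma> \<and>
    \<sigma> 0 = \<sigma>\<^sub>0 \<and>
    (\<forall>t\<in>{0<..<T}. (\<sigma> has_vector_derivative f t (\<sigma> t)) (at t))"

end

theory Submission
  imports Defs
begin

text \<open>
  The support functions form a closed convex cone \<open>K\<close> in the Banach space of continuous functions on
  the sphere. The cone is stable under Minkowski sums and dilations of the bodies
  (\<open>support_funs_conic_combination\<close>), and a uniform limit of support functions is the support
  function of the intersection of the half-spaces that it describes (\<open>closed_support_funs\<close>). A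
  vector \<open>\<tau> - c *\<^sub>R \<sigma>\<close> with \<open>\<tau> \<in> K\<close> and \<open>c \<ge> 0\<close> points from \<open>\<sigma>\<close> into \<open>K\<close>: for \<open>r * c \<le> 1\<close> the point
  \<open>\<sigma> + r *\<^sub>R (\<tau> - c *\<^sub>R \<sigma>) = (1 - r * c) *\<^sub>R \<sigma> + r *\<^sub>R \<tau>\<close> is again in the cone. So the tangency
  hypothesis says that \<open>f t \<sigma>\<close> is a limit of directions in which one can move along a short segment
  inside \<open>K\<close>, and the theorem becomes a case of Nagumo's invariance theorem for Lipschitz fields
  on closed subsets of a Banach space, which is proved in the locale \<open>subtangent_field\<close>.

  The lengths of the admissible segments are not bounded below, so Euler polygons with a fixed
  step do not exist. A curve follows the field up to \<open>e\<close> if at every time its right difference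
  quotients are eventually within \<open>e\<close> of the field. This is a condition on germs. It is
  therefore inherited by unions of chains of partial curves, and a maximal chain yields a curve that
  cannot be extended. Since partial curves are Lipschitz, they have an end point in \<open>K\<close>, where
  another short segment can be attached; hence the maximal curve fills the whole time interval
  (\<open>partial_solution_full_length\<close>).

  A Gronwall inequality for right Dini derivatives shows that two curves that follow the field up to
  \<open>e\<close> and start at the same point stay within a multiple of \<open>e\<close> of each other
  (\<open>approximate_solutions_close\<close>). This gives uniqueness, and it also makes the approximate solutions
  a uniform Cauchy sequence as \<open>e\<close> tends to 0. The limit stays in the closed set \<open>K\<close>, and a mean value
  inequality with right Dini derivatives shows that it is differentiable and solves the equation.
\<close>

section \<open>Inequalities from right Dini derivatives\<close>

text \<open>
  A continuous induction along the interval: the last time before \<open>t\<close> at which the inequality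
  holds cannot be earlier than \<open>t\<close>, since the inequality persists for a moment after it.
\<close>

lemma le_by_right_extension:
  fixes g \<phi> :: "real \<Rightarrow> real"
  assumes cont: "continuous_on {a..b} g" "continuous_on {a..b} \<phi>"
    and init: "g a \<le> \<phi> a"
    and extend: "\<And>t. a \<le> t \<Longrightarrow> t < b \<Longrightarrow> g t \<le> \<phi> t \<Longrightarrow> \<forall>\<^sub>F r in at_right t. g r \<le> \<phi> r"
    and t: "t \<in> {a..b}"
  shows "g t \<le> \<phi> t"
proof (rule ccontr)
  assume neg: "\<not> g t \<le> \<phi> t"
  define S where "S = {r \<in> {a..t}. g r \<le> \<phi> r}"
  have "closed S"
    unfolding S_def using t
    by (intro continuous_on_closed_Collect_le continuous_on_subset[OF cont(1)]
        continuous_on_subset[OF cont(2)]) auto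
  moreover have "a \<in> S" "bdd_above S"
    using init t by (auto simp: S_def)
  ultimately have m: "Sup S \<in> S"
    by (intro closed_contains_Sup) auto
  define m where "m = Sup S"
  have "m < t" "a \<le> m" "g m \<le> \<phi> m"
    using m neg by (auto simp: S_def m_def less_le)
  then have "\<forall>\<^sub>F r in at_right m. g r \<le> \<phi> r \<and> r \<in> {m<..<t}"
    using extend[of m] t eventually_at_right_real[of m t] by (auto intro: eventually_conj)
  then obtain r where r: "g r \<le> \<phi> r" "m < r" "r < t"
    by (force dest: eventually_happens)
  then have "r \<in> S"
    using \<open>a \<le> m\<close> by (auto simp: S_def)
  then have "r \<le> m"
    unfolding m_def using \<open>bdd_above S\<close> by (rule cSup_upper)
  with r show False by simp
qed

text \<open>
  The comparison function \<open>2 * e * exp ((L + 1) * t)\<close> grows strictly faster than the hypothesis allows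
  \<open>g\<close> to grow and lies above its own tangents. It is positive at 0, so near 0 continuity of \<open>g\<close>
  suffices and the growth condition is needed only in the open interval, where solutions of the
  initial value problem are differentiable.
\<close>

lemma Gronwall_right_Dini:
  fixes g :: "real \<Rightarrow> real"
  assumes cont: "continuous_on {0..s} g"
    and "g 0 \<le> 0" "L \<ge> 0" "e > 0"
    and growth: "\<And>t. 0 < t \<Longrightarrow> t < s \<Longrightarrow> \<forall>\<^sub>F r in at_right t. g r \<le> g t + (r - t) * (L * g t + e)"
    and t: "t \<in> {0..s}"
  shows "g t \<le> 2 * e * exp ((L + 1) * t)"
proof (rule le_by_right_extension[OF cont _ _ _ t])
  show "continuous_on {0..s} (\<lambda>t. 2 * e * exp ((L + 1) * t))"
    by (intro continuous_intros)
  show "g 0 \<le> 2 * e * exp ((L + 1) * 0)"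
    using assms by simp
  fix t assume t: "0 \<le> t" "t < s" and le: "g t \<le> 2 * e * exp ((L + 1) * t)"
  show "\<forall>\<^sub>F r in at_right t. g r \<le> 2 * e * exp ((L + 1) * r)"
  \<comment> \<open>At time 0 the strict inequality \<open>g 0 < 2 * e\<close> is used, later the growth condition.\<close>
  proof (cases "t = 0")
    case True
    have "(g \<longlongrightarrow> g 0) (at_right 0)"
      using cont t True by (metis at_within_Icc_at_right atLeastAtMost_iff continuous_on_def less_eq_real_def)
    then have "\<forall>\<^sub>F r in at_right 0. g r < 2 * e"
      using assms by (auto intro: order_tendstoD(2))
    then have "\<forall>\<^sub>F r in at_right 0. g r \<le> 2 * e * exp ((L + 1) * r)"
      using eventually_at_right_less[of 0]
    proof eventually_elim
      case (elim r)
      have "2 * e * 1 \<le> 2 * e * exp ((L + 1) * r)"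
        using elim assms by (intro mult_left_mono) auto
      with elim show ?case by linarith
    qed
    with True show ?thesis by simp
  next
    case False
    with t have "0 < t" by simp
    from growth[OF this \<open>t < s\<close>] eventually_at_right_less[of t] show ?thesis
    proof eventually_elim
      case (elim r)
      define E where "E = exp ((L + 1) * t)"
      have E: "E \<ge> 1" using t assms by (simp add: E_def)
      have "L * g t + e \<le> L * (2 * e * E) + e"
        using le assms by (simp add: E_def mult_left_mono)
      also have "\<dots> \<le> (L + 1) * (2 * e * E)"
      proof -
        have "e * 1 \<le> e * E" using E assms by (intro mult_left_mono) auto
        moreover have "0 \<le> e * E" using E assms by simp
        ultimately show ?thesis by (simp add: algebra_simps)
      qed
      finally have "g r \<le> 2 * e * E + (r - t) * ((L + 1) * (2 * e * E))"
        using elim le by (smt (verit) E_def mult_left_mono)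
      also have "\<dots> = 2 * e * E * (1 + (L + 1) * (r - t))"
        by (simp add: algebra_simps)
      also have "\<dots> \<le> 2 * e * E * exp ((L + 1) * (r - t))"
        using E assms by (intro mult_left_mono exp_ge_add_one_self) auto
      also have "\<dots> = 2 * e * exp ((L + 1) * r)"
      proof -
        have "(L + 1) * r = (L + 1) * t + (L + 1) * (r - t)"
          by (simp add: algebra_simps)
        then show ?thesis
          by (simp only: E_def exp_add mult.assoc)
      qed
      finally show ?case .
    qed
  qed
qed

text \<open>
  With \<open>w = 0\<close> this yields Lipschitz bounds; with \<open>w\<close> a value of the field it yields derivatives of
  uniform limits.
\<close>

lemma mean_value_right_Dini:
  fixes u :: "real \<Rightarrow> 'b::real_normed_vector"
  assumes cont: "continuous_on {a..b} u" and "a \<le> b"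
    and slope: "\<And>t. a \<le> t \<Longrightarrow> t < b \<Longrightarrow>
      \<forall>\<^sub>F r in at_right t. norm (u r - u t - (r - t) *\<^sub>R w) \<le> c * (r - t)"
  shows "norm (u b - u a - (b - a) *\<^sub>R w) \<le> c * (b - a)"
proof (rule le_by_right_extension[where a = a and b = b and t = b])
  fix t assume t: "a \<le> t" "t < b" and le: "norm (u t - u a - (t - a) *\<^sub>R w) \<le> c * (t - a)"
  show "\<forall>\<^sub>F r in at_right t. norm (u r - u a - (r - a) *\<^sub>R w) \<le> c * (r - a)"
    using slope[OF t]
  proof eventually_elim
    case (elim r)
    have "u r - u a - (r - a) *\<^sub>R w = (u r - u t - (r - t) *\<^sub>R w) + (u t - u a - (t - a) *\<^sub>R w)"
      by (simp add: algebra_simps)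
    then have "norm (u r - u a - (r - a) *\<^sub>R w) \<le> c * (r - t) + c * (t - a)"
      by (simp only: norm_triangle_mono[OF elim le])
    then show ?case by (simp add: algebra_simps)
  qed
qed (use assms in \<open>auto intro!: continuous_intros\<close>)

section \<open>Lipschitz fields that are subtangent to a closed set\<close>

text \<open>
  The subtangency condition asks for whole segments in \<open>K\<close>, not only for points near \<open>K\<close> as in
  the Bouligand condition, so that polygons with these segments as edges run inside \<open>K\<close>, where the
  field is defined.
\<close>

locale subtangent_field =
  fixes T L :: real and K :: "'b::banach set" and f :: "real \<Rightarrow> 'b \<Rightarrow> 'b"
  assumes T_pos: "T > 0" and L_nonneg: "L \<ge> 0" and closed_K: "closed K"
    and f_cont: "continuous_on ({0..T} \<times> K) (\<lambda>(t, x). f t x)"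
    and f_lipschitz: "\<And>t x y. t \<in> {0..T} \<Longrightarrow> x \<in> K \<Longrightarrow> y \<in> K \<Longrightarrow>
      norm (f t x - f t y) \<le> L * norm (x - y)"
    and f_subtangent: "\<And>t x e. t \<in> {0..T} \<Longrightarrow> x \<in> K \<Longrightarrow> e > 0 \<Longrightarrow>
      \<exists>v h. norm (v - f t x) < e \<and> h > 0 \<and> (\<forall>r\<in>{0..h}. x + r *\<^sub>R v \<in> K)"
begin

text \<open>
  Only the slope to the right is constrained, so that a polygon may satisfy the condition at its
  vertices too.
\<close>

definition follows :: "real \<Rightarrow> (real \<Rightarrow> 'b) \<Rightarrow> real \<Rightarrow> bool"
  where "follows e u t \<longleftrightarrow>
    (\<forall>\<^sub>F r in at_right t. norm (u r - u t - (r - t) *\<^sub>R f t (u t)) \<le> e * (r - t))"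

lemma follows_increment:
  assumes "follows e u t" "norm (f t (u t) - w) \<le> c"
  shows "\<forall>\<^sub>F r in at_right t. norm (u r - u t - (r - t) *\<^sub>R w) \<le> (e + c) * (r - t)"
  using assms(1)[unfolded follows_def] eventually_at_right_less[of t]
proof eventually_elim
  case (elim r)
  have "norm ((r - t) *\<^sub>R (f t (u t) - w)) \<le> c * (r - t)"
    using elim assms(2) by (simp add: mult.commute mult_left_mono)
  from norm_triangle_mono[OF elim(1) this] show ?case
    by (simp add: algebra_simps)
qed

lemma follows_cong:
  assumes "\<forall>\<^sub>F r in at_right t. u r = w r" "u t = w t"
  shows "follows e u t \<longleftrightarrow> follows e w t"
  unfolding follows_def
  by (rule eventually_cong[OF assms(1)]) (simp add: assms(2))

lemma has_vector_derivative_imp_follows: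
  assumes "(u has_vector_derivative f t (u t)) (at t)" "e > 0"
  shows "follows e u t"
proof -
  obtain d where "d > 0"
    and d: "\<And>r. norm (r - t) < d \<Longrightarrow> norm (u r - u t - (r - t) *\<^sub>R f t (u t)) \<le> e * norm (r - t)"
    using assms unfolding has_vector_derivative_def has_derivative_at_alt by blast
  have "\<forall>\<^sub>F r in at_right t. r \<in> {t<..<t + d}"
    using \<open>d > 0\<close> by (intro eventually_at_right_real) simp
  then show ?thesis
    unfolding follows_def
  proof eventually_elim
    case (elim r)
    then show ?case using d[of r] by simp
  qed
qed

text \<open>
  Applied with the same \<open>e\<close> to exact solutions this gives uniqueness, and to polygons the Cauchy
  property. The difference \<open>norm (u t - w t)\<close> grows at most at the rate
  \<open>L * norm (u t - w t) + 2 * e\<close>: the Lipschitz bound for the field, plus the defects of both curves.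
\<close>

lemma approximate_solutions_close:
  assumes cont: "continuous_on {0..T} u" "continuous_on {0..T} w"
    and K: "\<And>t. t \<in> {0..T} \<Longrightarrow> u t \<in> K" "\<And>t. t \<in> {0..T} \<Longrightarrow> w t \<in> K"
    and "u 0 = w 0" and "e > 0"
    and follows: "\<And>t. t \<in> {0<..<T} \<Longrightarrow> follows e u t" "\<And>t. t \<in> {0<..<T} \<Longrightarrow> follows e w t"
    and t: "t \<in> {0..T}"
  shows "norm (u t - w t) \<le> 4 * e * exp ((L + 1) * t)"
proof -
  have "norm (u t - w t) \<le> 2 * (2 * e) * exp ((L + 1) * t)"
  proof (rule Gronwall_right_Dini[OF _ _ L_nonneg _ _ t])
    fix t assume t: "0 < t" "t < T"
    have lip: "norm (f t (u t) - f t (w t)) \<le> L * norm (u t - w t)"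
      using t K by (intro f_lipschitz) auto
    have "\<forall>\<^sub>F r in at_right t. norm (w r - w t - (r - t) *\<^sub>R f t (w t)) \<le> e * (r - t)"
      using follows(2)[of t] t by (simp add: follows_def)
    moreover have "\<forall>\<^sub>F r in at_right t. norm (u r - u t - (r - t) *\<^sub>R f t (w t))
        \<le> (e + L * norm (u t - w t)) * (r - t)"
      using t by (intro follows_increment[OF follows(1) lip]) auto
    ultimately show "\<forall>\<^sub>F r in at_right t. norm (u r - w r)
        \<le> norm (u t - w t) + (r - t) * (L * norm (u t - w t) + 2 * e)"
    proof eventually_elim
      case (elim r)
      have "u r - w r = (u t - w t) + ((u r - u t - (r - t) *\<^sub>R f t (w t))
          - (w r - w t - (r - t) *\<^sub>R f t (w t)))"
        by simp
      then have "norm (u r - w r) \<le> norm (u t - w t) +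
          ((e + L * norm (u t - w t)) * (r - t) + e * (r - t))"
        using elim by (metis add_mono norm_triangle_le norm_triangle_le_diff order_refl)
      then show ?case by (simp add: algebra_simps)
    qed
  qed (use assms in \<open>auto intro!: continuous_intros\<close>)
  then show ?thesis by simp
qed

section \<open>Approximate solutions on the whole time interval\<close>

text \<open>
  The domain \<open>{0..<s}\<close> is half-open, so that an increasing union of domains is again of this form;
  \<open>s = 0\<close> is allowed as the starting point of the construction. Continuity refers to \<open>{0..}\<close> and
  not to the domain: in this way the condition at each \<open>t < s\<close> does not mention \<open>s\<close>.
\<close>

definition partial_solution :: "real \<Rightarrow> 'b \<Rightarrow> real \<Rightarrow> (real \<Rightarrow> 'b) \<Rightarrow> bool"
  where "partial_solution e x s u \<longleftrightarrow> s \<in> {0..T} \<and> (s > 0 \<longrightarrow> u 0 = x) \<and>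
    (\<forall>t\<in>{0..<s}. u t \<in> K \<and> continuous (at t within {0..}) u \<and> follows e u t)"

lemma partial_solution_continuous_on:
  assumes "partial_solution e x s u" "a \<ge> 0" "b < s"
  shows "continuous_on {a..b} u"
  unfolding continuous_on_eq_continuous_within
proof
  fix t assume "t \<in> {a..b}"
  then have "continuous (at t within {0..}) u" "{a..b} \<subseteq> {0..}"
    using assms by (auto simp: partial_solution_def)
  then show "continuous (at t within {a..b}) u"
    by (rule continuous_within_subset)
qed

text \<open>
  The field grows at most linearly with the distance from \<open>x\<close>, so Gronwall bounds that distance,
  hence the field along the curve, hence the slopes.
\<close>

lemma partial_solution_Lipschitz:
  assumes u: "partial_solution e x s u" and "x \<in> K" "e > 0"
  shows "\<exists>B. \<forall>a b. 0 \<le> a \<longrightarrow> a \<le> b \<longrightarrow> b < s \<longrightarrow> norm (u b - u a) \<le> B * (b - a)"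
proof -
  have s: "s \<le> T" and u0: "s > 0 \<Longrightarrow> u 0 = x"
    and uK: "\<And>t. t \<in> {0..<s} \<Longrightarrow> u t \<in> K" and fol: "\<And>t. t \<in> {0..<s} \<Longrightarrow> follows e u t"
    using u by (auto simp: partial_solution_def)
  have "continuous_on {0..T} (\<lambda>t. (\<lambda>(t, x). f t x) (t, x))"
    using \<open>x \<in> K\<close> by (intro continuous_on_compose2[OF f_cont]) (auto intro!: continuous_intros)
  then have "bounded ((\<lambda>t. f t x) ` {0..T})"
    by (intro compact_imp_bounded compact_continuous_image) auto
  then obtain M where "M > 0" and M: "\<And>t. t \<in> {0..T} \<Longrightarrow> norm (f t x) \<le> M"
    by (auto simp: bounded_pos)
  have f_le: "norm (f t (u t) - 0) \<le> L * norm (u t - x) + M" if "t \<in> {0..<s}" for t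
    using f_lipschitz[OF _ uK[OF that] \<open>x \<in> K\<close>, of t] M[of t] that s
      norm_triangle_sub[of "f t (u t)" "f t x"] by auto
  define R where "R = 2 * (e + M) * exp ((L + 1) * T)"
  have R: "norm (u t - x) \<le> R" if t: "t \<in> {0..<s}" for t
  proof -
    have "norm (u t - x) \<le> 2 * (e + M) * exp ((L + 1) * t)"
    proof (rule Gronwall_right_Dini[OF _ _ L_nonneg])
      show "continuous_on {0..t} (\<lambda>r. norm (u r - x))"
        using t by (intro continuous_intros partial_solution_continuous_on[OF u]) auto
      fix r assume "0 < r" "r < t"
      then have r: "r \<in> {0..<s}" using t by auto
      from follows_increment[OF fol[OF r] f_le[OF r]]
      show "\<forall>\<^sub>F q in at_right r. norm (u q - x)
          \<le> norm (u r - x) + (q - r) * (L * norm (u r - x) + (e + M))"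
      proof eventually_elim
        case (elim q)
        have "norm (u q - x) \<le> norm (u r - x) + norm (u q - u r)"
          using norm_triangle_ineq[of "u r - x" "u q - u r"] by simp
        with elim show ?case by (simp add: algebra_simps)
      qed
    qed (use t u0 \<open>M > 0\<close> \<open>e > 0\<close> in auto)
    also have "\<dots> \<le> R"
      unfolding R_def using \<open>M > 0\<close> \<open>e > 0\<close> t s L_nonneg by (intro mult_left_mono) auto
    finally show ?thesis .
  qed
  show ?thesis
  proof (intro exI allI impI)
    fix a b assume ab: "0 \<le> a" "a \<le> b" "b < s"
    have "norm (u b - u a - (b - a) *\<^sub>R 0) \<le> (e + (L * R + M)) * (b - a)"
    proof (rule mean_value_right_Dini[OF partial_solution_continuous_on[OF u]])
      fix t assume "a \<le> t" "t < b"
      then have t: "t \<in> {0..<s}" using ab by auto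
      have "norm (f t (u t) - 0) \<le> L * R + M"
        using f_le[OF t] mult_left_mono[OF R[OF t] L_nonneg] by linarith
      with fol[OF t] show "\<forall>\<^sub>F r in at_right t.
          norm (u r - u t - (r - t) *\<^sub>R 0) \<le> (e + (L * R + M)) * (r - t)"
        by (rule follows_increment)
    qed (use ab in auto)
    then show "norm (u b - u a) \<le> (e + (L * R + M)) * (b - a)" by simp
  qed
qed

text \<open>
  For \<open>s = 0\<close> the filter is trivial and the last clause singles out the initial value as the end
  point, which lets \<open>partial_solution_extend\<close> treat the first segment like the later ones.
\<close>

lemma partial_solution_limit:
  assumes u: "partial_solution e x s u" and "x \<in> K" "e > 0"
  obtains y where "y \<in> K" "(u \<longlongrightarrow> y) (at s within {0..<s})" "s = 0 \<Longrightarrow> y = x"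
proof (cases "s = 0")
  case True
  show ?thesis
    by (rule that[OF \<open>x \<in> K\<close>]) (simp_all add: True)
next
  case False
  then have s: "s > 0" using u by (auto simp: partial_solution_def)
  obtain B where B: "\<And>a b. 0 \<le> a \<Longrightarrow> a \<le> b \<Longrightarrow> b < s \<Longrightarrow> norm (u b - u a) \<le> B * (b - a)"
    using partial_solution_Lipschitz[OF assms] by blast
  have ordered: "norm (u b - u a) \<le> \<bar>B\<bar> * \<bar>b - a\<bar>" if "0 \<le> a" "a \<le> b" "b < s" for a b
  proof -
    have "B * (b - a) \<le> \<bar>B * (b - a)\<bar>" by (rule abs_ge_self)
    with B[OF that] show ?thesis unfolding abs_mult by (rule order_trans)
  qed
  have "\<bar>B\<bar>-lipschitz_on {0..<s} u"
  proof (rule lipschitz_onI)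
    fix a b assume "a \<in> {0..<s}" "b \<in> {0..<s}"
    then show "dist (u a) (u b) \<le> \<bar>B\<bar> * dist a b"
      using ordered[of a b] ordered[of b a]
      by (cases "a \<le> b") (auto simp: dist_norm norm_minus_commute abs_minus_commute)
  qed simp
  then have "uniformly_continuous_on {0..<s} u"
    by (rule lipschitz_on_uniformly_continuous)
  moreover have "s \<in> closure {0..<s}"
    using s by simp
  ultimately obtain y where y: "(u \<longlongrightarrow> y) (at s within {0..<s})"
    by (rule uniformly_continuous_on_extension_at_closure)
  have "at s within {0..<s} \<noteq> bot"
    using s by (simp add: at_within_eq_bot_iff)
  moreover have "\<forall>\<^sub>F t in at s within {0..<s}. u t \<in> K"
    using u by (auto simp: eventually_at_filter partial_solution_def)
  ultimately have "y \<in> K"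
    using Lim_in_closed_set[OF closed_K _ _ y] by blast
  then show ?thesis
    by (rule that[OF _ y]) (use s in simp)
qed

text \<open>
  Half of the error \<open>e\<close> is spent on replacing the field by an admissible direction, the other half
  on the variation of the field along the segment.
\<close>

lemma short_segment:
  assumes "s \<in> {0..<T}" "y \<in> K" "e > 0"
  obtains v h where "h > 0" "s + h \<le> T" "\<And>r. r \<in> {0..h} \<Longrightarrow> y + r *\<^sub>R v \<in> K"
    "\<And>r. r \<in> {0..h} \<Longrightarrow> norm (v - f (s + r) (y + r *\<^sub>R v)) \<le> e"
proof -
  obtain v h where v: "norm (v - f s y) < e / 2" "h > 0" "\<And>r. r \<in> {0..h} \<Longrightarrow> y + r *\<^sub>R v \<in> K"
    using f_subtangent[of s y "e / 2"] assms by force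
  define h1 where "h1 = min h (T - s)"
  have h1: "h1 > 0" "h1 \<le> h" "s + h1 \<le> T" using v assms by (auto simp: h1_def)
  have "continuous_on {0..h1} (\<lambda>r. (\<lambda>(t, x). f t x) (s + r, y + r *\<^sub>R v))"
    by (rule continuous_on_compose2[OF f_cont])
       (use v h1 assms in \<open>auto intro!: continuous_intros\<close>)
  then obtain d where "d > 0" and
    d: "\<And>r. r \<in> {0..h1} \<Longrightarrow> \<bar>r\<bar> < d \<Longrightarrow> norm (f (s + r) (y + r *\<^sub>R v) - f s y) < e / 2"
    using h1 \<open>e > 0\<close>
    by (elim continuous_onE[of _ _ 0 "e / 2"]) (auto simp: dist_norm)
  show ?thesis
  proof (rule that[of "min h1 (d / 2)" v])
    fix r assume r: "r \<in> {0..min h1 (d / 2)}"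
    have "norm (f (s + r) (y + r *\<^sub>R v) - f s y) < e / 2"
      using r \<open>d > 0\<close> by (intro d) auto
    with v(1) show "norm (v - f (s + r) (y + r *\<^sub>R v)) \<le> e"
      by (smt (verit) norm_diff_triangle_less norm_minus_commute field_sum_of_halves)
  qed (use v h1 \<open>d > 0\<close> in auto)
qed

lemma partial_solution_extend:
  assumes u: "partial_solution e x s u" and "s < T" and "x \<in> K" "e > 0"
  obtains s' w where "s < s'" "partial_solution e x s' w" "\<And>t. t < s \<Longrightarrow> w t = u t"
proof -
  have s: "0 \<le> s" using u by (simp add: partial_solution_def)
  obtain y where y: "y \<in> K" "(u \<longlongrightarrow> y) (at s within {0..<s})" "s = 0 \<Longrightarrow> y = x"
    using partial_solution_limit[OF assms(1,3,4)] by metis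
  obtain v h where h: "h > 0" "s + h \<le> T" and vK: "\<And>r. r \<in> {0..h} \<Longrightarrow> y + r *\<^sub>R v \<in> K"
    and v: "\<And>r. r \<in> {0..h} \<Longrightarrow> norm (v - f (s + r) (y + r *\<^sub>R v)) \<le> e"
    using short_segment[of s y e] s assms y by (metis atLeastLessThan_iff)
  define w where "w = (\<lambda>t. if t < s then u t else y + (t - s) *\<^sub>R v)"
  have line: "continuous (at t within S) (\<lambda>t. y + (t - s) *\<^sub>R v)" for t S
    by (intro continuous_intros)
  have "w t \<in> K \<and> continuous (at t within {0..}) w \<and> follows e w t" if t: "t \<in> {0..<s + h}" for t
  proof (cases "t < s")
    case True
    have "\<forall>\<^sub>F r in nhds t. r < s"
      using True by (intro eventually_nhds_in_open[of "{..<s}", simplified]) auto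
    then have eq: "\<forall>\<^sub>F r in nhds t. w r = u r"
      by eventually_elim (simp add: w_def)
    have "continuous (at t within {0..}) w \<longleftrightarrow> continuous (at t within {0..}) u"
      unfolding continuous_within
      by (intro Lim_cong_within filterlim_cong) (use eq True in \<open>auto simp: w_def eventually_at_filter elim: eventually_mono\<close>)
    moreover have "follows e w t \<longleftrightarrow> follows e u t"
      by (rule follows_cong) (use eq True in \<open>auto simp: w_def eventually_at_filter elim: eventually_mono\<close>)
    ultimately show ?thesis
      using u True t by (auto simp: partial_solution_def w_def)
  next
    case False
    then have t': "t - s \<in> {0..h}" "w t = y + (t - s) *\<^sub>R v"
      using t by (auto simp: w_def)
    have slope: "norm (v - f t (w t)) \<le> e"
      using v[OF t'(1)] t'(2) by simp
    have "\<forall>\<^sub>F r in at_right t. norm (w r - w t - (r - t) *\<^sub>R f t (w t)) \<le> e * (r - t)"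
      using eventually_at_right_less[of t]
    proof (eventually_elim)
      case (elim r)
      have "w r - w t - (r - t) *\<^sub>R f t (w t) = (r - t) *\<^sub>R (v - f t (w t))"
        using False elim t'(2) by (simp add: w_def algebra_simps)
      with elim slope show ?case by (simp add: mult.commute mult_left_mono)
    qed
    moreover have "continuous (at t within {0..}) w"
    proof -
      have "(w \<longlongrightarrow> w t) (at t within {s..})"
        using line[of t "{s..}"] False t'(2) unfolding continuous_within
        by (auto simp: w_def intro: Lim_transform_eventually simp: eventually_at_filter)
      moreover have "(w \<longlongrightarrow> w t) (at t within {0..<s})"
      proof (cases "t = s")
        case True
        have "(w \<longlongrightarrow> y) (at s within {0..<s})"
          by (rule Lim_transform_eventually[OF y(2)]) (auto simp: w_def eventually_at_filter)
        with True show ?thesis by (simp add: w_def)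
      next
        case ts: False
        have "closure ({0..<s} - {t}) \<subseteq> {..s}"
          by (rule closure_minimal) auto
        then have "at t within {0..<s} = bot"
          using False ts by (auto simp: at_within_eq_bot_iff)
        then show ?thesis by simp
      qed
      moreover have "{0..} = {0..<s} \<union> {s..}" using s by auto
      ultimately show ?thesis
        unfolding continuous_within by (auto intro: Lim_Un)
    qed
    ultimately show ?thesis
      using vK[OF t'(1)] t'(2) by (simp add: follows_def)
  qed
  moreover have "w 0 = x"
    using s u y by (auto simp: w_def partial_solution_def)
  ultimately have "partial_solution e x (s + h) w"
    using s h by (auto simp: partial_solution_def)
  then show ?thesis
    using h by (intro that[of "s + h" w]) (auto simp: w_def)
qed

text \<open>
  The curves of \<open>C\<close> agree on common domains, so they glue to a function on the union. At each time
  the union has the germ of some member of \<open>C\<close>, and all conditions concern germs.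
\<close>

lemma partial_solution_chain_union:
  assumes sol: "\<And>s u. (s, u) \<in> C \<Longrightarrow> partial_solution e x s u"
    and chain: "\<And>s u s' u' t. (s, u) \<in> C \<Longrightarrow> (s', u') \<in> C \<Longrightarrow> 0 \<le> t \<Longrightarrow> t < s \<Longrightarrow> t < s' \<Longrightarrow> u t = u' t"
    and "C \<noteq> {}"
  obtains s w where "partial_solution e x s w"
    "\<And>s' u. (s', u) \<in> C \<Longrightarrow> s' \<le> s" "\<And>s' u t. (s', u) \<in> C \<Longrightarrow> 0 \<le> t \<Longrightarrow> t < s' \<Longrightarrow> w t = u t"
proof -
  define s where "s = Sup (fst ` C)"
  have bdd: "bdd_above (fst ` C)"
    using sol by (intro bdd_aboveI[of _ T]) (force simp: partial_solution_def)
  have le_s: "s' \<le> s" if "(s', u) \<in> C" for s' u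
    unfolding s_def using that bdd by (force intro: cSup_upper)
  have ex: "\<exists>s' u. (s', u) \<in> C \<and> t < s'" if "t < s" for t
    using that less_cSup_iff[OF _ bdd] \<open>C \<noteq> {}\<close> unfolding s_def by force
  define w where "w = (\<lambda>t. (SOME z. \<exists>s' u. (s', u) \<in> C \<and> t < s' \<and> z = u t))"
  have w: "w t = u t" if "(s', u) \<in> C" "0 \<le> t" "t < s'" for s' u t
  proof -
    have "\<exists>s' u. (s', u) \<in> C \<and> t < s' \<and> w t = u t"
      unfolding w_def by (rule someI_ex) (use that in blast)
    with that chain show ?thesis by metis
  qed
  have "w t \<in> K \<and> continuous (at t within {0..}) w \<and> follows e w t" if t: "t \<in> {0..<s}" for t
  proof -
    obtain s' u where C: "(s', u) \<in> C" and ts': "t < s'" using ex[of t] t by (metis atLeastLessThan_iff)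
    have "\<forall>\<^sub>F r in nhds t. r < s'"
      using ts' by (intro eventually_nhds_in_open[of "{..<s'}", simplified]) auto
    then have eq: "\<forall>\<^sub>F r in nhds t. 0 \<le> r \<longrightarrow> w r = u r"
      by eventually_elim (use w[OF C] in auto)
    have eqt: "w t = u t" using w[OF C] t ts' by auto
    have "continuous (at t within {0..}) w \<longleftrightarrow> continuous (at t within {0..}) u"
      unfolding continuous_within
      by (intro filterlim_cong) (use eq eqt in \<open>auto simp: eventually_at_filter elim: eventually_mono\<close>)
    moreover have "follows e w t \<longleftrightarrow> follows e u t"
      by (rule follows_cong) (use eq eqt t in \<open>auto simp: eventually_at_filter elim: eventually_mono\<close>)
    ultimately show ?thesis
      using sol[OF C] t ts' eqt by (auto simp: partial_solution_def)
  qed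
  moreover have "s \<in> {0..T}"
  proof -
    obtain s' u where C: "(s', u) \<in> C" using \<open>C \<noteq> {}\<close> by auto
    have "s \<le> T" unfolding s_def using \<open>C \<noteq> {}\<close> sol
      by (intro cSup_least) (force simp: partial_solution_def)+
    with le_s[OF C] sol[OF C] show ?thesis by (auto simp: partial_solution_def)
  qed
  moreover have "w 0 = x" if pos: "s > 0"
  proof -
    obtain s' u where C: "(s', u) \<in> C" and "0 < s'" using ex[OF pos] by metis
    with w[OF C, of 0] sol[OF C] show ?thesis by (auto simp: partial_solution_def)
  qed
  ultimately show ?thesis
    using le_s w by (intro that[of s w]) (auto simp: partial_solution_def)
qed

text \<open>
  Hausdorff's maximal principle, applied to partial solutions ordered by extension. It places no
  requirement on the relation, and so tolerates that two curves with the same restriction to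
  \<open>{0..<s}\<close> are different functions, which breaks antisymmetry. An extension of the union of a maximal
  chain would prolong that chain.
\<close>

lemma partial_solution_full_length:
  assumes "x \<in> K" "e > 0"
  shows "\<exists>u. partial_solution e x T u"
proof -
  define A where "A = {(s, u). partial_solution e x s u}"
  define less where "less = (\<lambda>(s :: real, u) (s', u'). s \<le> s' \<and> (\<forall>t\<in>{0..<s}. u t = (u' t :: 'b)))"
  obtain C where C: "pred_on.maxchain A less C"
    using pred_on.Hausdorff by blast
  then have chain: "pred_on.chain A less C"
    by (rule pred_on.maxchain_imp_chain)
  then have CA: "C \<subseteq> A" and cmp: "\<And>p q. p \<in> C \<Longrightarrow> q \<in> C \<Longrightarrow> less p q \<or> less q p \<or> p = q"
    unfolding pred_on.chain_def by blast+
  have "partial_solution e x 0 u" for u :: "real \<Rightarrow> 'b"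
    using T_pos by (simp add: partial_solution_def)
  then have "pred_on.chain A less {(0, \<lambda>_. x)}"
    by (auto simp: pred_on.chain_def A_def)
  then have "C \<noteq> {}"
    using C unfolding pred_on.maxchain_def by blast
  obtain s w where w: "partial_solution e x s w"
    and le_s: "\<And>s' u. (s', u) \<in> C \<Longrightarrow> s' \<le> s"
    and w_eq: "\<And>s' u t. (s', u) \<in> C \<Longrightarrow> 0 \<le> t \<Longrightarrow> t < s' \<Longrightarrow> w t = u t"
  proof (rule partial_solution_chain_union[OF _ _ \<open>C \<noteq> {}\<close>, of e x])
    fix s u assume "(s, u) \<in> C"
    then show "partial_solution e x s u" using CA by (auto simp: A_def)
  next
    fix s u s' u' t
    assume "(s, u) \<in> C" "(s', u') \<in> C" "0 \<le> t" "t < s" "t < s'"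
    then show "u t = u' t"
      using cmp[of "(s, u)" "(s', u')"] by (auto simp: less_def)
  qed blast
  have "s = T"
  proof (rule ccontr)
    assume "s \<noteq> T"
    then have "s < T" using w by (auto simp: partial_solution_def)
    from partial_solution_extend[OF w this assms]
    obtain s' w' where s': "s < s'" "partial_solution e x s' w'" and w': "\<And>t. t < s \<Longrightarrow> w' t = w t"
      by metis
    have above: "less p (s', w')" if p: "p \<in> C" for p
    proof -
      obtain s1 u where p: "p = (s1, u)" "(s1, u) \<in> C" using p by (cases p) auto
      have "u t = w' t" if "t \<in> {0..<s1}" for t
        using w_eq[OF p(2)] w'[of t] le_s[OF p(2)] that by auto
      with le_s[OF p(2)] s' p show ?thesis by (auto simp: less_def)
    qed
    have "pred_on.chain A less (insert (s', w') C)"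
    proof -
      have "(s', w') \<in> A" using s'(2) by (simp add: A_def)
      with CA cmp above show ?thesis
        unfolding pred_on.chain_def by blast
    qed
    moreover have "(s', w') \<notin> C"
      using le_s s'(1) by fastforce
    ultimately show False
      using C unfolding pred_on.maxchain_def by blast
  qed
  with w show ?thesis by auto
qed

lemma approximate_solution_exists:
  assumes "x \<in> K" "e > 0"
  shows "\<exists>u. continuous_on {0..T} u \<and> u ` {0..T} \<subseteq> K \<and> u 0 = x \<and> (\<forall>t\<in>{0..<T}. follows e u t)"
proof -
  obtain u where u: "partial_solution e x T u"
    using partial_solution_full_length[OF assms] by blast
  obtain y where y: "y \<in> K" "(u \<longlongrightarrow> y) (at T within {0..<T})"
    using partial_solution_limit[OF u assms] by metis
  define w where "w = u(T := y)"
  have "continuous (at t within {0..T}) w" if t: "t \<in> {0..T}" for t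
  proof (cases "t = T")
    case True
    have "{0..T} - {T} = {0..<T} - {T}" by auto
    then have "at T within {0..T} = at T within {0..<T}"
      by (simp only: at_within_def)
    moreover have "(w \<longlongrightarrow> y) (at T within {0..<T})"
      by (rule Lim_transform_eventually[OF y(2)]) (auto simp: w_def eventually_at_filter)
    ultimately show ?thesis
      using True by (simp add: continuous_within w_def)
  next
    case False
    then have "t < T" using t by auto
    then have "\<forall>\<^sub>F r in nhds t. r < T"
      by (intro eventually_nhds_in_open[of "{..<T}", simplified]) auto
    then have "\<forall>\<^sub>F r in nhds t. w r = u r"
      by eventually_elim (simp add: w_def)
    moreover have "w t = u t"
      using False by (simp add: w_def)
    ultimately have "continuous (at t within {0..T}) w \<longleftrightarrow> continuous (at t within {0..T}) u"
      unfolding continuous_within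
      by (intro filterlim_cong) (auto simp: eventually_at_filter elim: eventually_mono)
    moreover have "continuous (at t within {0..T}) u"
    proof (rule continuous_within_subset)
      show "continuous (at t within {0..}) u"
        using u \<open>t < T\<close> t by (auto simp: partial_solution_def)
    qed auto
    ultimately show ?thesis by simp
  qed
  moreover have "follows e w t" if t: "t \<in> {0..<T}" for t
  proof -
    have "\<forall>\<^sub>F r in at_right t. r \<in> {t<..<T}"
      using t by (intro eventually_at_right_real) auto
    then have "\<forall>\<^sub>F r in at_right t. w r = u r"
      by eventually_elim (simp add: w_def)
    then have "follows e w t \<longleftrightarrow> follows e u t"
      using t by (intro follows_cong) (auto simp: w_def)
    with u t show ?thesis by (auto simp: partial_solution_def)
  qed
  moreover have "w ` {0..T} \<subseteq> K" "w 0 = x"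
    using u y T_pos by (auto simp: w_def partial_solution_def)
  ultimately show ?thesis
    by (intro exI[of _ w]) (auto simp: continuous_on_eq_continuous_within)
qed

section \<open>Existence and uniqueness of solutions\<close>

text \<open>
  Near \<open>t\<close>, the field along the limit curve is within \<open>\<eta> / 3\<close> of \<open>f t (w t)\<close>, and along \<open>u n\<close> it is within
  another \<open>\<eta> / 3\<close> for large \<open>n\<close>. The curve \<open>u n\<close> itself misses the field by at most \<open>e n < \<eta> / 3\<close>. By
  the mean value inequality an increment of \<open>u n\<close> near \<open>t\<close> differs from that of the line with slope
  \<open>f t (w t)\<close> by at most \<open>\<eta>\<close> times the elapsed time, and this bound passes to the limit.
\<close>

lemma uniform_limit_solution:
  assumes cont: "\<And>n. continuous_on {0..T} (u n)" and uK: "\<And>n t. t \<in> {0..T} \<Longrightarrow> u n t \<in> K"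
    and fol: "\<And>n t. t \<in> {0..<T} \<Longrightarrow> follows (e n) (u n) t"
    and e: "e \<longlonglongrightarrow> 0"
    and lim: "uniform_limit {0..T} u w sequentially"
    and t: "t \<in> {0..T}"
  shows "(w has_vector_derivative f t (w t)) (at t within {0..T})"
proof -
  have wcont: "continuous_on {0..T} w"
    using uniform_limit_theorem[OF _ lim] cont by simp
  have wK: "w r \<in> K" if "r \<in> {0..T}" for r
    using closed_sequentially[OF closed_K, of "\<lambda>n. u n r"] uK[OF that] tendsto_uniform_limitI[OF lim that]
    by auto
  have fw: "continuous_on {0..T} (\<lambda>r. (\<lambda>(t, x). f t x) (r, w r))"
    by (rule continuous_on_compose2[OF f_cont]) (use wK in \<open>auto intro!: continuous_intros wcont\<close>)
  have key: "\<exists>d>0. \<forall>r\<in>{0..T}. norm (r - t) < d \<longrightarrow>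
      norm (w r - w t - (r - t) *\<^sub>R f t (w t)) \<le> \<eta> * norm (r - t)" if "\<eta> > 0" for \<eta>
  proof -
    obtain d where "d > 0"
      and d: "\<And>r. r \<in> {0..T} \<Longrightarrow> \<bar>r - t\<bar> < d \<Longrightarrow> norm (f r (w r) - f t (w t)) < \<eta> / 3"
      using fw t \<open>\<eta> > 0\<close>
      by (elim continuous_onE[of _ _ t "\<eta> / 3"]) (auto simp: dist_norm)
    have main: "norm (w b - w a - (b - a) *\<^sub>R f t (w t)) \<le> \<eta> * (b - a)"
      if ab: "0 \<le> a" "a \<le> b" "b \<le> T" and near: "\<And>r. r \<in> {a..b} \<Longrightarrow> \<bar>r - t\<bar> < d" for a b
    proof (rule tendsto_upperbound)
      show "(\<lambda>n. norm (u n b - u n a - (b - a) *\<^sub>R f t (w t)))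
          \<longlonglongrightarrow> norm (w b - w a - (b - a) *\<^sub>R f t (w t))"
        using ab by (intro tendsto_intros tendsto_uniform_limitI[OF lim]) auto
      \<comment> \<open>The denominator contains \<open>L + 1\<close> and not \<open>L\<close>, since \<open>L\<close> may be 0.\<close>
      have pos: "\<eta> / (3 * (L + 1)) > 0" "\<eta> / 3 > 0"
        using \<open>\<eta> > 0\<close> L_nonneg by auto
      have "\<forall>\<^sub>F n in sequentially. e n < \<eta> / 3"
        using order_tendstoD(2)[OF e pos(2)] .
      then show "\<forall>\<^sub>F n in sequentially. norm (u n b - u n a - (b - a) *\<^sub>R f t (w t)) \<le> \<eta> * (b - a)"
        using uniform_limitD[OF lim pos(1)]
      proof eventually_elim
        case (elim n)
        show ?case
        proof (rule mean_value_right_Dini)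
          show "continuous_on {a..b} (u n)"
            using ab by (intro continuous_on_subset[OF cont]) auto
          fix r assume r: "a \<le> r" "r < b"
          then have rT: "r \<in> {0..T}" "r \<in> {0..<T}" using ab by auto
          have "norm (f r (u n r) - f r (w r)) \<le> L * norm (u n r - w r)"
            using rT uK wK by (intro f_lipschitz) auto
          also have "\<dots> \<le> (L + 1) * (\<eta> / (3 * (L + 1)))"
            using elim(2) rT L_nonneg by (intro mult_mono) (auto simp: dist_norm less_imp_le)
          also have "\<dots> = \<eta> / 3" using L_nonneg by (simp add: field_simps)
          finally have "norm (f r (u n r) - f t (w t)) \<le> \<eta> / 3 + \<eta> / 3"
            using d[OF rT(1)] near[of r] r by (intro norm_diff_triangle_le) (auto simp: less_imp_le)
          from follows_increment[OF fol[OF rT(2)] this] eventually_at_right_less[of r]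
          show "\<forall>\<^sub>F q in at_right r. norm (u n q - u n r - (q - r) *\<^sub>R f t (w t)) \<le> \<eta> * (q - r)"
          proof eventually_elim
            case (elim q)
            have "(e n + (\<eta> / 3 + \<eta> / 3)) * (q - r) \<le> \<eta> * (q - r)"
              using elim(2) \<open>e n < \<eta> / 3\<close> by (intro mult_right_mono) auto
            with elim(1) show ?case by linarith
          qed
        qed (rule ab)
      qed
    qed simp
    show ?thesis
    proof (intro exI[of _ d] conjI ballI impI)
      fix r assume r: "r \<in> {0..T}" "norm (r - t) < d"
      show "norm (w r - w t - (r - t) *\<^sub>R f t (w t)) \<le> \<eta> * norm (r - t)"
      proof (cases "t \<le> r")
        case True
        then show ?thesis using main[of t r] r t by auto
      next
        case False
        have "w r - w t - (r - t) *\<^sub>R f t (w t) = - (w t - w r - (t - r) *\<^sub>R f t (w t))"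
          by (simp add: algebra_simps)
        with main[of r t] False r t show ?thesis
          by (simp only: norm_minus_cancel) auto
      qed
    qed (rule \<open>d > 0\<close>)
  qed
  show ?thesis
    unfolding has_vector_derivative_def has_derivative_within_alt
    using key by (auto simp: bounded_linear_scaleR_left)
qed

theorem solution_exists:
  assumes "x \<in> K"
  obtains w where "continuous_on {0..T} w" "\<And>t. t \<in> {0..T} \<Longrightarrow> w t \<in> K" "w 0 = x"
    "\<And>t. t \<in> {0..T} \<Longrightarrow> (w has_vector_derivative f t (w t)) (at t within {0..T})"
proof -
  define e where "e = (\<lambda>n. inverse (real (Suc n)))"
  have e_pos: "e n > 0" for n by (simp add: e_def)
  have e_lim: "e \<longlonglongrightarrow> 0"
    unfolding e_def by (rule LIMSEQ_inverse_real_of_nat)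
  obtain u where cont: "\<And>n. continuous_on {0..T} (u n)"
    and uK: "\<And>n t. t \<in> {0..T} \<Longrightarrow> u n t \<in> K" and u0: "\<And>n. u n 0 = x"
    and fol: "\<And>n t. t \<in> {0..<T} \<Longrightarrow> follows (e n) (u n) t"
    using approximate_solution_exists[OF assms e_pos] by (metis image_subset_iff)
  have weaken: "follows b v t" if "follows a v t" "a \<le> b" for a b v t
    unfolding follows_def
    using that(1)[unfolded follows_def] eventually_at_right_less[of t]
  proof eventually_elim
    case (elim r)
    then show ?case using mult_right_mono[OF \<open>a \<le> b\<close>, of "r - t"] by linarith
  qed
  have "uniformly_Cauchy_on {0..T} u"
  proof (rule uniformly_Cauchy_onI)
    fix \<eta> :: real assume "\<eta> > 0"
    define E where "E = exp ((L + 1) * T)"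
    have "E > 0" by (simp add: E_def)
    obtain N where N: "e N < \<eta> / (4 * E)"
      using \<open>\<eta> > 0\<close> \<open>E > 0\<close> order_tendstoD(2)[OF e_lim, of "\<eta> / (4 * E)"]
      by (auto dest: eventually_happens)
    have mono: "e n \<le> e N" if "n \<ge> N" for n
      using that by (simp add: e_def)
    show "\<exists>M. \<forall>t\<in>{0..T}. \<forall>m\<ge>M. \<forall>n\<ge>M. dist (u m t) (u n t) < \<eta>"
    proof (intro exI[of _ N] ballI allI impI)
      fix t m n assume t: "t \<in> {0..T}" and mn: "N \<le> m" "N \<le> n"
      have "norm (u m t - u n t) \<le> 4 * e N * exp ((L + 1) * t)"
        by (rule approximate_solutions_close)
           (use cont uK u0 e_pos t mn in \<open>auto intro: weaken[OF fol mono]\<close>)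
      also have "\<dots> \<le> 4 * e N * E"
        unfolding E_def using t L_nonneg e_pos[of N] by (intro mult_left_mono) auto
      also have "\<dots> < \<eta>"
        using N \<open>E > 0\<close> by (simp add: field_simps)
      finally show "dist (u m t) (u n t) < \<eta>" by (simp add: dist_norm)
    qed
  qed
  then obtain w where lim: "uniform_limit {0..T} u w sequentially"
    using Cauchy_uniformly_convergent uniformly_convergent_on_def by metis
  show ?thesis
  proof (rule that)
    show "continuous_on {0..T} w"
      using uniform_limit_theorem[OF _ lim] cont by simp
    show "w t \<in> K" if "t \<in> {0..T}" for t
      using closed_sequentially[OF closed_K, of "\<lambda>n. u n t"] uK[OF that]
        tendsto_uniform_limitI[OF lim that] by auto
    have "(\<lambda>n. u n 0) \<longlonglongrightarrow> w 0"
      using T_pos by (intro tendsto_uniform_limitI[OF lim]) auto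
    then show "w 0 = x"
      by (simp add: u0 LIMSEQ_const_iff)
    show "(w has_vector_derivative f t (w t)) (at t within {0..T})" if "t \<in> {0..T}" for t
      by (rule uniform_limit_solution[OF cont uK fol e_lim lim that])
  qed
qed

theorem solution_unique:
  assumes "continuous_on {0..T} u" "continuous_on {0..T} w"
    and "\<And>t. t \<in> {0..T} \<Longrightarrow> u t \<in> K" "\<And>t. t \<in> {0..T} \<Longrightarrow> w t \<in> K"
    and "u 0 = w 0"
    and "\<And>t. t \<in> {0<..<T} \<Longrightarrow> (u has_vector_derivative f t (u t)) (at t)"
    and "\<And>t. t \<in> {0<..<T} \<Longrightarrow> (w has_vector_derivative f t (w t)) (at t)"
    and "t \<in> {0..T}"
  shows "u t = w t"
proof -
  have "norm (u t - w t) \<le> 0 + \<eta>" if "\<eta> > 0" for \<eta>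
  proof -
    define e where "e = \<eta> / (4 * exp ((L + 1) * t))"
    have "e > 0" using that by (simp add: e_def)
    then have "norm (u t - w t) \<le> 4 * e * exp ((L + 1) * t)"
      using assms by (intro approximate_solutions_close has_vector_derivative_imp_follows) auto
    then show ?thesis by (simp add: e_def)
  qed
  then have "norm (u t - w t) \<le> 0"
    by (rule field_le_epsilon)
  then show ?thesis by simp
qed

end

section \<open>The cone of support functions\<close>

instance bcontfun :: (metric_space, banach) banach ..

lemma support_fun_eqI:
  fixes A :: "'a::euclidean_space set"
  assumes "A \<in> convex_bodies"
    and "\<And>p a. a \<in> A \<Longrightarrow> point_of p \<bullet> a \<le> apply_bcontfun \<phi> p"
    and "\<And>p. \<exists>a\<in>A. point_of p \<bullet> a = apply_bcontfun \<phi> p"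
  shows "support_fun A = \<phi>"
proof (rule bcontfun_eqI)
  fix p
  have "apply_bcontfun \<phi> p \<in> (\<lambda>a. point_of p \<bullet> a) ` A"
    using assms(3)[of p] by force
  then have "(SUP a\<in>A. point_of p \<bullet> a) = apply_bcontfun \<phi> p"
    using assms(2) by (intro cSup_eq_maximum) auto
  then show "apply_bcontfun (support_fun A) p = apply_bcontfun \<phi> p"
    using assms(1) by (simp add: apply_support_fun)
qed

lemma support_fun_attained:
  fixes A :: "'a::euclidean_space set"
  assumes "A \<in> convex_bodies"
  shows "\<exists>a\<in>A. point_of p \<bullet> a = apply_bcontfun (support_fun A) p"
proof -
  have "compact A" "A \<noteq> {}" using assms by (auto simp: convex_bodies_def)
  then obtain a where a: "a \<in> A" "\<And>b. b \<in> A \<Longrightarrow> point_of p \<bullet> b \<le> point_of p \<bullet> a"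
    using continuous_attains_sup[of A "\<lambda>a. point_of p \<bullet> a"]
    by (force intro: continuous_intros)
  then have "(SUP a\<in>A. point_of p \<bullet> a) = point_of p \<bullet> a"
    by (intro cSup_eq_maximum) auto
  with a assms show ?thesis by (auto simp: apply_support_fun)
qed

lemma support_fun_upper:
  fixes A :: "'a::euclidean_space set"
  assumes "A \<in> convex_bodies" "a \<in> A"
  shows "point_of p \<bullet> a \<le> apply_bcontfun (support_fun A) p"
proof -
  have "compact ((\<lambda>a. point_of p \<bullet> a) ` A)"
    using assms by (intro compact_continuous_image) (auto simp: convex_bodies_def intro: continuous_intros)
  then have "bdd_above ((\<lambda>a. point_of p \<bullet> a) ` A)"
    by (intro bounded_imp_bdd_above compact_imp_bounded)
  with assms show ?thesis
    by (auto simp: apply_support_fun intro: cSUP_upper)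
qed

lemma support_funs_conic_combination:
  assumes "\<phi> \<in> support_funs" "\<psi> \<in> support_funs" "\<alpha> \<ge> 0" "\<beta> \<ge> 0"
  shows "\<alpha> *\<^sub>R \<phi> + \<beta> *\<^sub>R \<psi> \<in> support_funs"
proof -
  obtain A B where A: "A \<in> convex_bodies" "\<phi> = support_fun A"
    and B: "B \<in> convex_bodies" "\<psi> = support_fun B"
    using assms by (auto simp: support_funs_def)
  define g where "g = (\<lambda>(a, b). \<alpha> *\<^sub>R a + \<beta> *\<^sub>R b :: 'a)"
  have "linear g"
    by (rule linearI) (auto simp: g_def algebra_simps)
  then have body: "g ` (A \<times> B) \<in> convex_bodies"
    using A(1) B(1) by (auto simp: convex_bodies_def intro!: convex_linear_image convex_Times
        compact_continuous_image compact_Times linear_continuous_on linear_conv_bounded_linear[THEN iffD1])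
  have "support_fun (g ` (A \<times> B)) = \<alpha> *\<^sub>R \<phi> + \<beta> *\<^sub>R \<psi>"
  proof (rule support_fun_eqI[OF body])
    fix p z assume "z \<in> g ` (A \<times> B)"
    then obtain a b where "a \<in> A" "b \<in> B" "z = \<alpha> *\<^sub>R a + \<beta> *\<^sub>R b"
      by (auto simp: g_def)
    with A B assms show "point_of p \<bullet> z \<le> apply_bcontfun (\<alpha> *\<^sub>R \<phi> + \<beta> *\<^sub>R \<psi>) p"
      by (auto simp: inner_add_right intro!: add_mono mult_left_mono support_fun_upper)
  next
    fix p
    obtain a b where "a \<in> A" "point_of p \<bullet> a = apply_bcontfun \<phi> p"
      "b \<in> B" "point_of p \<bullet> b = apply_bcontfun \<psi> p"
      using support_fun_attained A B by metis
    then show "\<exists>z\<in>g ` (A \<times> B). point_of p \<bullet> z = apply_bcontfun (\<alpha> *\<^sub>R \<phi> + \<beta> *\<^sub>R \<psi>) p"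
      by (intro bexI[of _ "g (a, b)"]) (auto simp: g_def inner_add_right)
  qed
  with body show ?thesis by (force simp: support_funs_def)
qed

text \<open>
  Let \<open>\<phi>\<close> be the uniform limit of support functions of bodies \<open>A n\<close>, and \<open>W\<close> the intersection of the
  half-spaces \<open>point_of p \<bullet> x \<le> \<phi> p\<close>. Points of \<open>A n\<close> that maximize \<open>point_of p \<bullet> x\<close> have an
  accumulation point, which lies in \<open>W\<close> and satisfies \<open>point_of p \<bullet> x = \<phi> p\<close>. So every half-space
  is touched by \<open>W\<close>. This proves that \<open>W\<close> is nonempty and has support function \<open>\<phi>\<close> without a
  construction of the Hausdorff limit of the bodies.
\<close>

lemma closed_support_funs: "closed (support_funs :: ('a::euclidean_space usphere \<Rightarrow>\<^sub>C real) set)"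
proof (rule closed_sequential_limits[THEN iffD2], intro allI impI, elim conjE)
  fix \<phi>s :: "nat \<Rightarrow> 'a usphere \<Rightarrow>\<^sub>C real" and \<phi>
  assume "\<forall>n. \<phi>s n \<in> support_funs" and lim: "\<phi>s \<longlonglongrightarrow> \<phi>"
  then have "\<forall>n. \<exists>A\<in>convex_bodies. \<phi>s n = support_fun A"
    by (auto simp: support_funs_def)
  then obtain A where A: "\<And>n. A n \<in> convex_bodies" and \<phi>s: "\<And>n. \<phi>s n = support_fun (A n)"
    by metis
  have lim_at: "(\<lambda>n. apply_bcontfun (\<phi>s n) p) \<longlonglongrightarrow> apply_bcontfun \<phi> p" for p
  proof (rule Lim_null_comparison[THEN LIM_zero_cancel])
    show "(\<lambda>n. dist (\<phi>s n) \<phi>) \<longlonglongrightarrow> 0"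
      using tendsto_dist_iff lim by blast
    have "norm (apply_bcontfun (\<phi>s n) p - apply_bcontfun \<phi> p) \<le> dist (\<phi>s n) \<phi>" for n
      using dist_bounded[of "\<phi>s n" p \<phi>] by (simp only: dist_norm)
    then show "\<forall>\<^sub>F n in sequentially. norm (apply_bcontfun (\<phi>s n) p - apply_bcontfun \<phi> p) \<le> dist (\<phi>s n) \<phi>"
      by (rule always_eventually[OF allI])
  qed
  define W where "W = {x. \<forall>p. point_of p \<bullet> x \<le> apply_bcontfun \<phi> p}"
  have norm_le: "norm x \<le> M" if M: "\<And>p. point_of p \<bullet> x \<le> M" for x :: 'a and M
  proof (cases "x = 0")
    case True
    with M show ?thesis by simp
  next
    case False
    then have "sgn x \<in> sphere 0 1" by (simp add: norm_sgn)
    then have "point_of (Usphere (sgn x)) = sgn x" by (rule Usphere_inverse)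
    moreover have "sgn x \<bullet> x = norm x"
      using False by (simp add: sgn_div_norm dot_square_norm power2_eq_square)
    ultimately show ?thesis
      using M[of "Usphere (sgn x)"] by simp
  qed
  have attained: "\<exists>a\<in>W. point_of p \<bullet> a = apply_bcontfun \<phi> p" for p
  proof -
    have "\<forall>n. \<exists>a\<in>A n. point_of p \<bullet> a = apply_bcontfun (\<phi>s n) p"
      using support_fun_attained[OF A] \<phi>s by simp
    then obtain a where aA: "\<And>n. a n \<in> A n" and a: "\<And>n. point_of p \<bullet> a n = apply_bcontfun (\<phi>s n) p"
      by metis
    have up: "point_of q \<bullet> a n \<le> apply_bcontfun (\<phi>s n) q" for q n
      using support_fun_upper[OF A aA] \<phi>s by simp
    have "Bseq \<phi>s"
      using lim by (intro convergent_imp_Bseq) (auto simp: convergent_def)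
    then obtain M where M: "\<And>n. norm (\<phi>s n) \<le> M" by (auto simp: Bseq_def)
    have "norm (a n) \<le> M" for n
    proof (rule norm_le)
      fix q
      have "apply_bcontfun (\<phi>s n) q \<le> norm (\<phi>s n)"
        using norm_bounded[of "\<phi>s n" q] by simp
      with up[of q n] M[of n] show "point_of q \<bullet> a n \<le> M" by linarith
    qed
    then have "bounded (range a)"
      by (auto simp: bounded_iff)
    then obtain l r where r: "strict_mono r" and l: "(a \<circ> r) \<longlonglongrightarrow> l"
      using bounded_imp_convergent_subsequence by blast
    have sub: "(\<lambda>n. apply_bcontfun (\<phi>s (r n)) q) \<longlonglongrightarrow> apply_bcontfun \<phi> q" for q
      using LIMSEQ_subseq_LIMSEQ[OF lim_at r] by (simp add: o_def)
    have inner: "(\<lambda>n. point_of q \<bullet> a (r n)) \<longlonglongrightarrow> point_of q \<bullet> l" for q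
      using l by (intro tendsto_intros) (simp add: o_def)
    have "l \<in> W"
      unfolding W_def using up by (auto intro: LIMSEQ_le[OF inner sub])
    moreover have "point_of p \<bullet> l = apply_bcontfun \<phi> p"
      using LIMSEQ_unique[OF inner[of p]] sub[of p] by (simp add: a)
    ultimately show ?thesis by blast
  qed
  have "W \<in> convex_bodies"
  proof -
    have W: "W = (\<Inter>p. {x. point_of p \<bullet> x \<le> apply_bcontfun \<phi> p})"
      by (auto simp: W_def)
    have "convex W" "closed W"
      unfolding W by (auto intro!: convex_INT convex_halfspace_le closed_INT closed_halfspace_le)
    moreover have "norm x \<le> norm \<phi>" if "x \<in> W" for x
    proof (rule norm_le)
      fix p
      have "apply_bcontfun \<phi> p \<le> norm \<phi>" using norm_bounded[of \<phi> p] by simp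
      then show "point_of p \<bullet> x \<le> norm \<phi>" using that by (force simp: W_def intro: order_trans)
    qed
    then have "bounded W" by (auto simp: bounded_iff)
    moreover have "W \<noteq> {}" using attained by blast
    ultimately show ?thesis by (simp add: convex_bodies_def compact_eq_bounded_closed)
  qed
  moreover have "support_fun W = \<phi>"
    by (rule support_fun_eqI) (use \<open>W \<in> convex_bodies\<close> attained in \<open>auto simp: W_def\<close>)
  ultimately show "\<phi> \<in> support_funs"
    by (auto simp: support_funs_def)
qed

text \<open>
  On a short segment the coefficient \<open>1 - r * c\<close> of \<open>\<sigma>\<close> in \<open>\<sigma> + r *\<^sub>R (\<tau> - c *\<^sub>R \<sigma>)\<close> stays nonnegative.
\<close>

lemma support_funs_segment:
  assumes "\<sigma> \<in> support_funs" "v \<in> support_funs_minus_ray \<sigma>"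
  obtains h where "h > 0" "\<And>r. r \<in> {0..h} \<Longrightarrow> \<sigma> + r *\<^sub>R v \<in> support_funs"
proof -
  obtain \<tau> c where v: "v = \<tau> - c *\<^sub>R \<sigma>" "\<tau> \<in> support_funs" "c \<ge> 0"
    using assms(2) by (auto simp: support_funs_minus_ray_def)
  show ?thesis
  \<comment> \<open>The bound \<open>1 / (c + 1)\<close> ensures \<open>r * c \<le> 1\<close> and is positive even for \<open>c = 0\<close>.\<close>
  proof (rule that[of "1 / (c + 1)"])
    fix r assume r: "r \<in> {0..1 / (c + 1)}"
    then have "r * c \<le> 1" using v(3) by (auto simp: field_simps)
    moreover have "\<sigma> + r *\<^sub>R v = (1 - r * c) *\<^sub>R \<sigma> + r *\<^sub>R \<tau>"
      by (simp add: v(1) algebra_simps)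
    ultimately show "\<sigma> + r *\<^sub>R v \<in> support_funs"
      using support_funs_conic_combination[OF assms(1) v(2), of "1 - r * c" r] r by simp
  qed (use v(3) in simp)
qed

theorem theorem17:
  fixes T :: real
    and A\<^sub>0 :: "(real ^ 'n) set"
    and f :: "real \<Rightarrow> ((real ^ 'n) usphere \<Rightarrow>\<^sub>C real) \<Rightarrow> ((real ^ 'n) usphere \<Rightarrow>\<^sub>C real)"
  assumes "T > 0"
    and "A\<^sub>0 \<in> convex_bodies"
    and f_range: "\<forall>t\<in>{0..T}. \<forall>\<sigma>\<in>support_funs. f t \<sigma> \<in> diff_support_funs"
    and f_cont: "continuous_on ({0..T} \<times> support_funs) (\<lambda>(t, \<sigma>). f t \<sigma>)"
    and f_lipschitz: "\<exists>L>0. \<forall>t\<in>{0..T}. \<forall>A\<in>convex_bodies. \<forall>B\<in>convex_bodies.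
      norm (f t (support_fun A) - f t (support_fun B)) \<le> L * norm (support_fun A - support_fun B)"
    and f_tangent: "\<forall>t\<in>{0..T}. \<forall>\<sigma>\<in>support_funs. f t \<sigma> \<in> closure (support_funs_minus_ray \<sigma>)"
  shows "\<exists>!\<sigma>. ivp_solution T f (support_fun A\<^sub>0) \<sigma>"
proof -
  obtain L where "L > 0"
    and L: "\<And>t A B. t \<in> {0..T} \<Longrightarrow> A \<in> convex_bodies \<Longrightarrow> B \<in> convex_bodies \<Longrightarrow>
      norm (f t (support_fun A) - f t (support_fun B)) \<le> L * norm (support_fun A - support_fun B)"
    using f_lipschitz by blast
  interpret subtangent_field T L support_funs f
  proof
    fix t e :: real and \<sigma> :: "(real ^ 'n) usphere \<Rightarrow>\<^sub>C real"
    assume "t \<in> {0..T}" and \<sigma>: "\<sigma> \<in> support_funs" and "e > 0"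
    then obtain v where v: "v \<in> support_funs_minus_ray \<sigma>" "norm (v - f t \<sigma>) < e"
      using f_tangent closure_approachable[of "f t \<sigma>" "support_funs_minus_ray \<sigma>"]
      by (auto simp: dist_norm)
    with support_funs_segment[OF \<sigma> v(1)]
    show "\<exists>v h. norm (v - f t \<sigma>) < e \<and> h > 0 \<and> (\<forall>r\<in>{0..h}. \<sigma> + r *\<^sub>R v \<in> support_funs)"
      by metis
  qed (use \<open>T > 0\<close> \<open>L > 0\<close> closed_support_funs f_cont L in \<open>auto simp: support_funs_def\<close>)
  show ?thesis
  proof (rule ex_ex1I)
    have "support_fun A\<^sub>0 \<in> support_funs"
      using assms(2) by (auto simp: support_funs_def)
    then obtain w where w: "continuous_on {0..T} w" "\<And>t. t \<in> {0..T} \<Longrightarrow> w t \<in> support_funs"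
      "w 0 = support_fun A\<^sub>0"
      "\<And>t. t \<in> {0..T} \<Longrightarrow> (w has_vector_derivative f t (w t)) (at t within {0..T})"
      using solution_exists by metis
    define \<sigma> where "\<sigma> = restrict w {0..T}"
    have "(\<sigma> has_vector_derivative f t (\<sigma> t)) (at t)" if t: "t \<in> {0<..<T}" for t
    proof -
      have "(w has_vector_derivative f t (w t)) (at t within {0<..<T})"
        using t by (intro has_vector_derivative_within_subset[OF w(4)]) auto
      then have "(w has_vector_derivative f t (w t)) (at t)"
        using t at_within_open[of t "{0<..<T}"] by simp
      then have "(\<sigma> has_vector_derivative f t (w t)) (at t)"
        by (rule has_vector_derivative_transform_within_open[of _ _ _ "{0<..<T}"])
           (use t in \<open>auto simp: \<sigma>_def\<close>)
      with t show ?thesis by (simp add: \<sigma>_def)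
    qed
    moreover have "continuous_on {0..T} \<sigma>"
      using w(1) by (rule continuous_on_eq) (simp add: \<sigma>_def)
    ultimately have "ivp_solution T f (support_fun A\<^sub>0) \<sigma>"
      using w \<open>T > 0\<close> by (auto simp: ivp_solution_def \<sigma>_def)
    then show "\<exists>\<sigma>. ivp_solution T f (support_fun A\<^sub>0) \<sigma>"
      by blast
  next
    fix \<sigma> \<tau>
    assume \<sigma>: "ivp_solution T f (support_fun A\<^sub>0) \<sigma>" and \<tau>: "ivp_solution T f (support_fun A\<^sub>0) \<tau>"
    have "\<sigma> t = \<tau> t" if "t \<in> {0..T}" for t
      by (rule solution_unique[OF _ _ _ _ _ _ _ that])
         (use \<sigma> \<tau> in \<open>auto simp: ivp_solution_def PiE_iff\<close>)
    then show "\<sigma> = \<tau>"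
      using \<sigma> \<tau> by (intro extensionalityI[of _ "{0..T}"]) (auto simp: ivp_solution_def PiE_iff)
  qed
qed

end
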